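(* Let $m,n,x,y$ be positive integers such that $m,n$ are not both $1$ and $\gcd(x,y)=\gcd(m,y)=\gcd(n,x)=1$. Then $\tau_{xm,yn}=\tau_{m,n}$.
   Context: For positive integers $m,n$, the discrete torus is $T_{m\times n} := \{0,\ldots,m-1\}\times\{0,\ldots,n-1\}\subset\mathbb{Z}^2$, and $\pi_{m,n}:\mathbb{Z}^2\to T_{m\times n}$ is the map $(x,y)\mapsto (x \bmod m,\ y \bmod n)$. A line in $\mathbb{Z}^2$ is a set $\ell_{\mathbb{R}^2}\cap\mathbb{Z}^2$, where $\ell_{\mathbb{R}^2}$ is a line in $\mathbb{R}^2$ containing at least two points with integer coordinates (equivalently, a set $\{A+k(u,v): k\in\mathbb{Z}\}$ with $A\in\mathbb{Z}^2$, $u,v \in \mathbb{Z}$, $\gcd(u,v)=1$). A line on $T_{m\times n}$ is the image under $\pi_{m,n}$ of a line in $\mathbb{Z}^2$. Points of $T_{m\times n}$ are collinear if some line on $T_{m\times n}$ contains all of them. $\tau_{m,n}$ denotes the maximal number of points that can be placed on $T_{m\times n}$ so that no three (distinct) of these points are collinear. *)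

theory Defs
  imports "HOL-Analysis.Analysis"
begin

definition torus :: "nat \<Rightarrow> nat \<Rightarrow> (int \<times> int) set" where
  "torus m n = {0..<int m} \<times> {0..<int n}"

definition torus_proj :: "nat \<Rightarrow> nat \<Rightarrow> int \<times> int \<Rightarrow> int \<times> int" where
  "torus_proj m n = (\<lambda>(a, b). (a mod int m, b mod int n))"

definition lattice_points :: "(real \<times> real) set \<Rightarrow> (int \<times> int) set" where
  "lattice_points l = {(a, b). (real_of_int a, real_of_int b) \<in> l}"

definition lattice_line :: "(int \<times> int) set \<Rightarrow> bool" where
  "lattice_line L \<longleftrightarrow>
     (\<exists>l. affine l \<and> aff_dim l = 1 \<and>
       (\<exists>P\<in>lattice_points l. \<exists>Q\<in>lattice_points l. P \<noteq> Q) \<and>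
       L = lattice_points l)"

definition torus_line :: "nat \<Rightarrow> nat \<Rightarrow> (int \<times> int) set \<Rightarrow> bool" where
  "torus_line m n T \<longleftrightarrow> (\<exists>L. lattice_line L \<and> T = torus_proj m n ` L)"

text \<open>
  Two distinct points of the torus may lie on several common lines, so three pairwise
  collinear points need not be collinear: a single line has to contain all points at once.
\<close>

definition torus_collinear :: "nat \<Rightarrow> nat \<Rightarrow> (int \<times> int) set \<Rightarrow> bool" where
  "torus_collinear m n S \<longleftrightarrow> (\<exists>T. torus_line m n T \<and> S \<subseteq> T)"

definition no_three_collinear :: "nat \<Rightarrow> nat \<Rightarrow> (int \<times> int) set \<Rightarrow> bool" where
  "no_three_collinear m n S \<longleftrightarrow>
     (\<forall>P\<in>S. \<forall>Q\<in>S. \<forall>R\<in>S. P \<noteq> Q \<and> P \<noteq> R \<and> Q \<noteq> R \<longrightarrow> \<not> torus_collinear m n {P, Q, R})"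

definition torus_tau :: "nat \<Rightarrow> nat \<Rightarrow> nat" where
  "torus_tau m n = Max {card S | S. S \<subseteq> torus m n \<and> no_three_collinear m n S}"

lemma finite_torus: "finite (torus m n)"
  by (simp add: torus_def)

text \<open>The maximum in the definition of \<^const>\<open>torus_tau\<close> is over a finite nonempty set.\<close>

lemma torus_tau_wf:
  "finite {card S | S. S \<subseteq> torus m n \<and> no_three_collinear m n S}"
  "{card S | S. S \<subseteq> torus m n \<and> no_three_collinear m n S} \<noteq> {}"
proof -
  have "{card S | S. S \<subseteq> torus m n \<and> no_three_collinear m n S} \<subseteq> card ` Pow (torus m n)"
    by blast
  then show "finite {card S | S. S \<subseteq> torus m n \<and> no_three_collinear m n S}"
    by (rule finite_subset) (simp add: finite_torus)
  have "no_three_collinear m n {}"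
    by (simp add: no_three_collinear_def)
  then show "{card S | S. S \<subseteq> torus m n \<and> no_three_collinear m n S} \<noteq> {}"
    by blast
qed

lemma lattice_points_affine_hull:
  fixes a b u v g :: int
  assumes "coprime u v" "g \<noteq> 0"
  shows "lattice_points (affine hull {(of_int a, of_int b), (of_int (a + g * u), of_int (b + g * v))})
       = {(a + k * u, b + k * v) | k. True}" (is "lattice_points ?l = ?R")
proof -
  obtain r w where rw: "r * u + w * v = 1"
    using bezout_int[of u v] assms(1) by auto
  have mem: "(real_of_int p, real_of_int q) \<in> ?l \<longleftrightarrow>
      (\<exists>t::real. real_of_int p = a + t * (g * u) \<and> real_of_int q = b + t * (g * v))" for p q
    by (auto simp: affine_hull_2_alt image_iff)
  have "(\<exists>t::real. real_of_int p = a + t * (g * u) \<and> real_of_int q = b + t * (g * v)) \<longleftrightarrow>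
      (\<exists>k. p = a + k * u \<and> q = b + k * v)" for p q
  proof
    assume "\<exists>t::real. real_of_int p = a + t * (g * u) \<and> real_of_int q = b + t * (g * v)"
    then obtain t :: real where t: "real_of_int p = a + t * (g * u)" "real_of_int q = b + t * (g * v)"
      by blast
    define k where "k = r * (p - a) + w * (q - b)"
    have "real_of_int k = t * g * real_of_int (r * u + w * v)"
      unfolding k_def using t by (simp add: algebra_simps)
    then have k: "real_of_int k = t * g"
      using rw by simp
    have "real_of_int p = real_of_int (a + k * u)" "real_of_int q = real_of_int (b + k * v)"
      using t k by auto
    then show "\<exists>k. p = a + k * u \<and> q = b + k * v"
      using of_int_eq_iff by blast
  next
    assume "\<exists>k. p = a + k * u \<and> q = b + k * v"
    then obtain k where "p = a + k * u" "q = b + k * v"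
      by blast
    then show "\<exists>t::real. real_of_int p = a + t * (g * u) \<and> real_of_int q = b + t * (g * v)"
      using assms(2) by (intro exI[of _ "real_of_int k / real_of_int g"]) auto
  qed
  with mem show ?thesis
    by (auto simp: lattice_points_def)
qed

lemma lattice_line_iff:
  "lattice_line L \<longleftrightarrow>
     (\<exists>a b u v. coprime u v \<and> L = {(a + k * u, b + k * v) | k. True})"
proof
  assume "lattice_line L"
  then obtain l a b c d where l: "affine l" "aff_dim l = 1" "L = lattice_points l"
    and P: "(real_of_int a, real_of_int b) \<in> l" and Q: "(real_of_int c, real_of_int d) \<in> l"
    and ne: "(a, b) \<noteq> (c, d)"
    unfolding lattice_line_def lattice_points_def by auto
  let ?h = "affine hull {(real_of_int a, real_of_int b), (real_of_int c, real_of_int d)}"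
  have "?h \<subseteq> l"
    using P Q l(1) by (intro hull_minimal) blast+
  moreover have "aff_dim ?h = aff_dim l"
    using ne l(2) by simp
  ultimately have leq: "l = ?h"
    using affine_dim_equal[OF affine_affine_hull l(1)] by (metis insert_not_empty affine_hull_eq_empty)
  define g where "g = gcd (c - a) (d - b)"
  have "g \<noteq> 0"
    using ne by (auto simp: g_def)
  obtain u v where uv: "c - a = g * u" "d - b = g * v" "coprime u v"
    using gcd_coprime_exists[of "c - a" "d - b"] \<open>g \<noteq> 0\<close>
    unfolding g_def[symmetric] by (auto simp: mult.commute)
  then have "c = a + g * u" "d = b + g * v"
    by auto
  then have "L = {(a + k * u, b + k * v) | k. True}"
    using lattice_points_affine_hull[OF uv(3) \<open>g \<noteq> 0\<close>] l(3) leq by simp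
  then show "\<exists>a b u v. coprime u v \<and> L = {(a + k * u, b + k * v) | k. True}"
    using uv(3) by blast
next
  assume "\<exists>a b u v. coprime u v \<and> L = {(a + k * u, b + k * v) | k. True}"
  then obtain a b u v where uv: "coprime u v" and L: "L = {(a + k * u, b + k * v) | k. True}"
    by blast
  have ne: "u \<noteq> 0 \<or> v \<noteq> 0"
    using uv by auto
  let ?l = "affine hull {(real_of_int a, real_of_int b),
                         (real_of_int (a + 1 * u), real_of_int (b + 1 * v))}"
  have L': "L = lattice_points ?l"
    using lattice_points_affine_hull[OF uv, of 1 a b] L by simp
  have "(a, b) \<in> lattice_points ?l" "(a + u, b + v) \<in> lattice_points ?l"
    by (auto simp: lattice_points_def hull_inc)
  moreover have "(a, b) \<noteq> (a + u, b + v)"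
    using ne by auto
  ultimately have "\<exists>P\<in>lattice_points ?l. \<exists>Q\<in>lattice_points ?l. P \<noteq> Q"
    by (intro bexI)
  moreover have "aff_dim ?l = 1"
    using ne by auto
  ultimately show "lattice_line L"
    unfolding lattice_line_def using L' by (intro exI[of _ ?l] conjI affine_affine_hull)
qed

end

theory Submission
  imports Defs "HOL-Number_Theory.Cong"
begin

text \<open>
  Collinearity on the torus only depends on the primes dividing both side lengths: at a prime
  dividing just one of them, a line can be made to cover the whole component, by the Chinese
  remainder theorem. Passing from \<open>(m, n)\<close> to \<open>(x m, y n)\<close> changes only components of the latter
  kind, so a set is collinear on the large torus iff its projection to the small one is. Since
  two points are always collinear, the projection is injective on a set of at least three points
  without collinear triples.
\<close>

section \<open>Collinearity as solvability of congruences\<close>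

text \<open>\<open>S\<close> is an arbitrary set of integer points rather than a subset of one
  torus, so that the same \<open>S\<close> can be compared under different moduli. The parameter
  \<open>k\<close> may vary with the point, but it has to serve both coordinates at once.\<close>

lemma torus_collinear_proj_iff:
  "torus_collinear m n (torus_proj m n ` S) \<longleftrightarrow>
    (\<exists>a b u v. coprime u v \<and>
      (\<forall>(p, q)\<in>S. \<exists>k. [p = a + k * u] (mod int m) \<and> [q = b + k * v] (mod int n)))"
proof -
  have "torus_proj m n ` S \<subseteq> torus_proj m n ` {(a + k * u, b + k * v) | k. True} \<longleftrightarrow>
      (\<forall>(p, q)\<in>S. \<exists>k. [p = a + k * u] (mod int m) \<and> [q = b + k * v] (mod int n))" for a b u v
    by (fastforce simp: torus_proj_def cong_def image_subset_iff image_iff)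
  moreover have "torus_collinear m n (torus_proj m n ` S) \<longleftrightarrow> (\<exists>a b u v. coprime u v \<and>
      torus_proj m n ` S \<subseteq> torus_proj m n ` {(a + k * u, b + k * v) | k. True})"
    unfolding torus_collinear_def torus_line_def lattice_line_iff by blast
  ultimately show ?thesis
    by simp
qed

text \<open>The integer line through \<open>P\<close> and \<open>Q\<close> already does it, once its
  direction is divided by the gcd of the coordinate differences.\<close>

lemma torus_collinear_pair:
  "torus_collinear m n (torus_proj m n ` {P, Q})"
proof -
  obtain a b c d where PQ: "P = (a, b)" "Q = (c, d)"
    by (meson surj_pair)
  obtain g u v where g: "coprime u v" "c = a + g * u" "d = b + g * v"
  proof (cases "P = Q")
    case True
    \<comment> \<open>For equal points any primitive direction works: here \<open>(1, 0)\<close>,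
      with multiple \<open>g = 0\<close>.\<close>
    with PQ that[of 1 0 0] show ?thesis by simp
  next
    case False
    then have "gcd (c - a) (d - b) \<noteq> 0"
      using PQ by auto
    from gcd_coprime_exists[OF this] show ?thesis
      by (metis that add_diff_cancel_left' diff_add_cancel mult.commute)
  qed
  have "\<exists>k. [a = a + k * u] (mod int m) \<and> [b = b + k * v] (mod int n)"
    by (intro exI[of _ 0]) simp
  moreover have "\<exists>k. [c = a + k * u] (mod int m) \<and> [d = b + k * v] (mod int n)"
    using g by (intro exI[of _ g]) simp
  ultimately show ?thesis
    unfolding torus_collinear_proj_iff PQ using g(1) by blast
qed

section \<open>Coprime representatives of residue classes\<close>

text \<open>The prime factors of \<open>m\<close> are sorted one at a time: those dividing
  \<open>n\<close> go to \<open>a\<close> with their full multiplicity, all others to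
  \<open>b\<close>. Taking \<open>gcd m n\<close> for \<open>a\<close> would not do, as the cofactor
  could still share primes with \<open>n\<close>. The general type serves both integers and
  naturals.\<close>

lemma ex_split_coprime_part:
  fixes m n :: "'a :: {factorial_semiring_gcd}"
  assumes "m \<noteq> 0"
  obtains a b where "m = a * b" "coprime b n" "\<And>p. prime p \<Longrightarrow> p dvd a \<Longrightarrow> p dvd n"
proof -
  have "\<exists>a b. m = a * b \<and> coprime b n \<and> (\<forall>p. prime p \<longrightarrow> p dvd a \<longrightarrow> p dvd n)"
    using assms
  proof (induction m rule: prime_divisors_induct)
    case zero
    then show ?case by simp
  next
    case (unit m)
    then show ?case
      by (intro exI[of _ 1] exI[of _ m]) (auto dest: not_prime_unit simp: is_unit_left_imp_coprime)
  next
    case (factor q m)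
    then obtain a b where ab: "m = a * b" "coprime b n" "\<forall>p. prime p \<longrightarrow> p dvd a \<longrightarrow> p dvd n"
      by auto
    show ?case
    proof (cases "q dvd n")
      case True
      have "p dvd n" if "prime p" "p dvd q * a" for p
        using that True factor.hyps ab(3) by (metis prime_dvd_mult_iff primes_dvd_imp_eq)
      with ab(1,2) show ?thesis
        by (intro exI[of _ "q * a"] exI[of _ b]) (auto simp: mult_ac)
    next
      case False
      then have "coprime (q * b) n"
        using factor.hyps ab(2) by (simp add: prime_imp_coprime)
      with ab(1,3) show ?thesis
        by (intro exI[of _ a] exI[of _ "q * b"]) (auto simp: mult_ac)
    qed
  qed
  with that show ?thesis by blast
qed

text \<open>Take for \<open>s\<close> the part \<open>b\<close> of \<open>g\<close> coprime to
  \<open>u\<close>. A prime factor of \<open>g\<close> divides exactly one of \<open>u\<close> and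
  \<open>m * b\<close>: if it divides \<open>b\<close>, it does not divide \<open>u\<close>;
  otherwise it divides \<open>u\<close>, hence neither \<open>m\<close> nor
  \<open>b\<close>.\<close>

lemma ex_coprime_in_residue_class:
  fixes u m g :: int
  assumes "g \<noteq> 0" "coprime (gcd u m) g"
  obtains s where "coprime (u + m * s) g"
proof -
  obtain a b where ab: "g = a * b" "coprime b u" "\<And>p. prime p \<Longrightarrow> p dvd a \<Longrightarrow> p dvd u"
    using ex_split_coprime_part[OF assms(1)] by metis
  have "coprime (u + m * b) g"
  proof (rule ccontr)
    assume "\<not> coprime (u + m * b) g"
    then have "\<not> is_unit (gcd (u + m * b) g)" "gcd (u + m * b) g \<noteq> 0"
      using assms(1) by (auto simp: coprime_iff_gcd_eq_1)
    then obtain p where p: "prime p" "p dvd u + m * b" "p dvd g"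
      by (metis prime_divisor_exists gcd_greatest_iff)
    from p(1,3) ab(1) consider "p dvd a" | "p dvd b"
      by (auto simp: prime_dvd_mult_iff)
    then show False
    proof cases
      case 1
      then have "p dvd u"
        using ab(3) p(1) by blast
      then have "p dvd m * b"
        using p(2) by (simp add: dvd_add_right_iff)
      moreover have "\<not> p dvd b"
        using \<open>p dvd u\<close> ab(2) p(1) by (meson coprime_common_divisor not_prime_unit)
      ultimately have "p dvd m"
        using p(1) by (simp add: prime_dvd_mult_iff)
      with \<open>p dvd u\<close> p(1,3) assms(2) show False
        by (meson coprime_common_divisor gcd_greatest not_prime_unit)
    next
      case 2
      then have "p dvd u"
        using p(2) by (simp add: dvd_add_left_iff)
      with 2 ab(2) p(1) show False
        by (meson coprime_common_divisor not_prime_unit)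
    qed
  qed
  with that show ?thesis by blast
qed

text \<open>This turns a direction known only modulo \<open>m\<close> and \<open>n\<close> into a
  primitive integer vector. First \<open>u'\<close> is made coprime to \<open>gcd v n\<close>; this
  is what then allows \<open>v\<close> to be shifted by a multiple of \<open>n\<close> to become
  coprime to \<open>u'\<close>.\<close>

lemma ex_coprime_in_residue_classes:
  fixes u v m n :: int
  assumes "m \<noteq> 0" "n \<noteq> 0" "coprime (gcd u v) (gcd m n)"
  obtains u' v' where "coprime u' v'" "[u' = u] (mod m)" "[v' = v] (mod n)"
proof -
  obtain u' where u': "u' \<noteq> 0" "coprime u' (gcd v n)" "[u' = u] (mod m)"
  proof -
    have "gcd (gcd u m) (gcd v n) = gcd (gcd u v) (gcd m n)"
      by (simp only: gcd.assoc gcd.left_commute[of m])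
    then have "coprime (gcd u m) (gcd v n)"
      using assms(3) unfolding coprime_iff_gcd_eq_1 by metis
    with assms(2) obtain s where s: "coprime (u + m * s) (gcd v n)"
      using ex_coprime_in_residue_class[of "gcd v n" u m] by auto
    show ?thesis
    proof (cases "u + m * s = 0")
      \<comment> \<open>The second shift needs \<open>u'\<close> nonzero. If the first one gives 0,
        then \<open>gcd v n\<close> is a unit and \<open>u\<close> is a multiple of
        \<open>m\<close>, so \<open>m\<close> itself is a nonzero replacement.\<close>
      case True
      with s have "is_unit (gcd v n)"
        by (simp only: coprime_0_left_iff)
      then have "coprime m (gcd v n)"
        by (rule is_unit_right_imp_coprime)
      moreover have "[m = u] (mod m)"
        using True by (simp add: cong_iff_dvd_diff dvd_diff_right_iff flip: eq_neg_iff_add_eq_0)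
      ultimately show ?thesis
        using assms(1) by (intro that[of m])
    next
      case False
      with s show ?thesis
        by (intro that[of "u + m * s"]) (simp_all add: cong_def)
    qed
  qed
  have "coprime (gcd v n) u'"
    using u'(2) by (simp add: coprime_commute)
  with u'(1) obtain t where "coprime (v + n * t) u'"
    by (rule ex_coprime_in_residue_class)
  with u'(3) show ?thesis
    by (intro that[of u' "v + n * t"]) (simp_all add: cong_def coprime_commute)
qed

section \<open>Transfer of collinearity between tori\<close>

lemma chinese_remainder_pair:
  fixes a b x y :: int
  assumes "coprime a b"
  obtains z where "[z = x] (mod a)" "[z = y] (mod b)"
  using binary_chinese_remainder_int[OF assms] by blast

text \<open>The new direction keeps its residues modulo \<open>a\<close> and \<open>b\<close> and is
  1 modulo \<open>c\<close> and \<open>d\<close>. Since \<open>c\<close> and \<open>d\<close> are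
  coprime to each other and to \<open>a * b\<close>, the parameter of each point can be kept modulo
  \<open>a * b\<close> and chosen freely modulo \<open>c\<close> and \<open>d\<close>, so the new
  components impose no condition.\<close>

lemma torus_collinear_proj_coprime_lift:
  fixes a b c d :: nat
  assumes pos: "a > 0" "b > 0" "c > 0" "d > 0"
    and cop: "coprime c (a * b)" "coprime d (a * b)" "coprime c d"
    and col: "torus_collinear a b (torus_proj a b ` S)"
  shows "torus_collinear (a * c) (b * d) (torus_proj (a * c) (b * d) ` S)"
proof -
  from col obtain r s u v where uv: "coprime u v"
    and S: "\<And>p q. (p, q) \<in> S \<Longrightarrow>
      \<exists>k. [p = r + k * u] (mod int a) \<and> [q = s + k * v] (mod int b)"
    unfolding torus_collinear_proj_iff by blast
  have cop': "coprime (int a) (int c)" "coprime (int b) (int d)"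
    "coprime (int a * int b) (int c * int d)" "coprime (int c) (int d)"
    using cop by (auto simp: coprime_commute simp flip: of_nat_mult)
  obtain u1 where u1: "[u1 = u] (mod int a)" "[u1 = 1] (mod int c)"
    using chinese_remainder_pair[OF cop'(1)] by blast
  obtain v1 where v1: "[v1 = v] (mod int b)" "[v1 = 1] (mod int d)"
    using chinese_remainder_pair[OF cop'(2)] by blast
  \<comment> \<open>Being 1 modulo \<open>c\<close> and \<open>d\<close> forces a common divisor to
    be coprime to both, hence to divide \<open>a\<close> and \<open>b\<close>; there
    \<open>u1\<close>, \<open>v1\<close> agree with the coprime pair \<open>u\<close>,
    \<open>v\<close>.\<close>
  have "coprime (gcd u1 v1) (gcd (int (a * c)) (int (b * d)))"
  proof (rule coprimeI)
    fix g assume g: "g dvd gcd u1 v1" "g dvd gcd (int (a * c)) (int (b * d))"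
    have "coprime u1 (int c)" "coprime v1 (int d)"
      using u1(2) v1(2) by (metis cong_imp_coprime cong_sym coprime_1_left)+
    then have "coprime g (int c)" "coprime g (int d)"
      using g(1) by (meson coprime_divisors dvd_refl gcd_greatest_iff)+
    with g(2) have "g dvd int a" "g dvd int b"
      by (auto simp: coprime_dvd_mult_left_iff)
    with g(1) u1(1) v1(1) have "g dvd u" "g dvd v"
      by (meson cong_dvd_iff cong_dvd_modulus gcd_greatest_iff)+
    with uv show "is_unit g"
      by (meson coprime_common_divisor)
  qed
  then obtain u' v' where uv': "coprime u' v'"
    and u'': "[u' = u1] (mod int (a * c))" and v'': "[v' = v1] (mod int (b * d))"
    using ex_coprime_in_residue_classes pos
    by (metis mult_pos_pos of_nat_0_less_iff order_less_irrefl)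
  have u': "[u' = u] (mod int a)" "[u' = 1] (mod int c)"
    using u'' u1 by (meson cong_trans cong_modulus_mult cong_dvd_modulus dvd_triv_left dvd_triv_right of_nat_dvd_iff)+
  have v': "[v' = v] (mod int b)" "[v' = 1] (mod int d)"
    using v'' v1 by (meson cong_trans cong_dvd_modulus dvd_triv_left dvd_triv_right of_nat_dvd_iff)+
  have "\<exists>k. [p = r + k * u'] (mod int (a * c)) \<and> [q = s + k * v'] (mod int (b * d))"
    if pq: "(p, q) \<in> S" for p q
  proof -
    obtain k where k: "[p = r + k * u] (mod int a)" "[q = s + k * v] (mod int b)"
      using S[OF pq] by blast
    \<comment> \<open>With direction 1 modulo \<open>c\<close> and \<open>d\<close>, the parameter
      has to equal the offset from the base point.\<close>
    obtain j where j: "[j = p - r] (mod int c)" "[j = q - s] (mod int d)"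
      using chinese_remainder_pair[OF cop'(4)] by blast
    obtain i where i: "[i = k] (mod int a * int b)" "[i = j] (mod int c * int d)"
      using chinese_remainder_pair[OF cop'(3)] by blast
    have ik: "[i = k] (mod int a)" "[i = k] (mod int b)"
      using i(1) by (meson cong_dvd_modulus dvd_triv_left dvd_triv_right)+
    have ij: "[i = p - r] (mod int c)" "[i = q - s] (mod int d)"
      using i(2) j by (meson cong_trans cong_dvd_modulus dvd_triv_left dvd_triv_right)+
    have "[r + i * u' = r + k * u] (mod int a)" "[s + i * v' = s + k * v] (mod int b)"
      "[r + i * u' = r + (p - r) * 1] (mod int c)" "[s + i * v' = s + (q - s) * 1] (mod int d)"
      by (intro cong_add cong_refl cong_mult ik ij u' v')+
    then have "[p = r + i * u'] (mod int a)" "[q = s + i * v'] (mod int b)"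
      "[p = r + i * u'] (mod int c)" "[q = s + i * v'] (mod int d)"
      using k by (auto intro: cong_trans cong_sym)
    then show ?thesis
      using cop' by (auto intro!: exI[of _ i] coprime_cong_mult)
  qed
  with uv' show ?thesis
    unfolding torus_collinear_proj_iff by blast
qed

lemma torus_collinear_proj_dvd:
  assumes "torus_collinear m n (torus_proj m n ` S)" "m' dvd m" "n' dvd n"
  shows "torus_collinear m' n' (torus_proj m' n' ` S)"
proof -
  have "[p = q] (mod int m')" if "[p = q] (mod int m)" for p q
    using that assms(2) by (meson cong_dvd_modulus of_nat_dvd_iff)
  moreover have "[p = q] (mod int n')" if "[p = q] (mod int n)" for p q
    using that assms(3) by (meson cong_dvd_modulus of_nat_dvd_iff)
  ultimately have "\<exists>k. [p = a + k * u] (mod int m') \<and> [q = b + k * v] (mod int n')"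
    if "\<exists>k. [p = a + k * u] (mod int m) \<and> [q = b + k * v] (mod int n)" for p q a b u v
    using that by blast
  then have mono: "\<forall>(p, q)\<in>S. \<exists>k. [p = a + k * u] (mod int m') \<and> [q = b + k * v] (mod int n')"
    if "\<forall>(p, q)\<in>S. \<exists>k. [p = a + k * u] (mod int m) \<and> [q = b + k * v] (mod int n)" for a b u v
    using that by fast
  obtain a b u v where "coprime u v"
    and "\<forall>(p, q)\<in>S. \<exists>k. [p = a + k * u] (mod int m) \<and> [q = b + k * v] (mod int n)"
    using assms(1) unfolding torus_collinear_proj_iff by blast
  with mono[of a u b v] show ?thesis
    unfolding torus_collinear_proj_iff by blast
qed

lemma coprime_if_prime_divisors:
  fixes a b n :: nat
  assumes "coprime b n" "\<And>p. prime p \<Longrightarrow> p dvd a \<Longrightarrow> p dvd n"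
  shows "coprime b a"
proof (rule ccontr)
  assume "\<not> coprime b a"
  then have "gcd b a \<noteq> 1"
    by (simp add: coprime_iff_gcd_eq_1)
  then obtain p where "prime p" "p dvd gcd b a"
    using prime_factor_nat by blast
  with assms show False
    by (meson coprime_common_divisor gcd_greatest_iff not_prime_unit)
qed

text \<open>Lifting from \<open>(m, n)\<close> by \<open>x\<close> and \<open>y\<close> directly is
  not possible in general, as \<open>x\<close> may share primes with \<open>m\<close>, and
  \<open>y\<close> with \<open>n\<close>. Instead both tori are compared with a common core
  \<open>(a, c)\<close>, which keeps only the primes dividing both \<open>m\<close> and
  \<open>n\<close>.\<close>

lemma torus_collinear_proj_mult_iff:
  fixes m n x y :: nat
  assumes pos: "m > 0" "n > 0" "x > 0" "y > 0"
    and cop: "coprime x y" "coprime m y" "coprime n x"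
  shows "torus_collinear (x * m) (y * n) (torus_proj (x * m) (y * n) ` S) \<longleftrightarrow>
    torus_collinear m n (torus_proj m n ` S)"
proof
  assume "torus_collinear (x * m) (y * n) (torus_proj (x * m) (y * n) ` S)"
  then show "torus_collinear m n (torus_proj m n ` S)"
    by (rule torus_collinear_proj_dvd) auto
next
  assume col: "torus_collinear m n (torus_proj m n ` S)"
  obtain a b where m: "m = a * b" "coprime b n" "\<And>p. prime p \<Longrightarrow> p dvd a \<Longrightarrow> p dvd n"
    using ex_split_coprime_part[of m n] pos by auto
  obtain c d where n: "n = c * d" "coprime d m" "\<And>p. prime p \<Longrightarrow> p dvd c \<Longrightarrow> p dvd m"
    using ex_split_coprime_part[of n m] pos by auto
  have pos': "a > 0" "b > 0" "c > 0" "d > 0"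
    using pos m(1) n(1) by auto
  have xb: "coprime (x * b) n" and yd: "coprime (y * d) m"
    using m(2) n(2) cop by (simp_all add: coprime_commute)
  have "coprime (x * b) a"
    using xb m(3) by (rule coprime_if_prime_divisors)
  moreover have "coprime (y * d) c"
    using yd n(3) by (rule coprime_if_prime_divisors)
  ultimately have "coprime (x * b) (a * c)" "coprime (y * d) (a * c)" "coprime (x * b) (y * d)"
    using xb yd m(1) n(1) cop by (auto simp: coprime_commute)
  \<comment> \<open>Forgetting \<open>b\<close> and \<open>d\<close> loses nothing: they are
    restored together with \<open>x\<close> and \<open>y\<close> in a single lift.\<close>
  moreover have "torus_collinear a c (torus_proj a c ` S)"
    using col by (rule torus_collinear_proj_dvd) (simp_all add: m(1) n(1))
  ultimately have "torus_collinear (a * (x * b)) (c * (y * d))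
      (torus_proj (a * (x * b)) (c * (y * d)) ` S)"
    using pos pos' by (intro torus_collinear_proj_coprime_lift) simp_all
  then show "torus_collinear (x * m) (y * n) (torus_proj (x * m) (y * n) ` S)"
    by (simp add: m(1) n(1) mult_ac)
qed

section \<open>Comparison of the maximal sets\<close>

lemma torus_proj_id: "P \<in> torus m n \<Longrightarrow> torus_proj m n P = P"
  by (auto simp: torus_def torus_proj_def)

lemma torus_proj_image_id: "S \<subseteq> torus m n \<Longrightarrow> torus_proj m n ` S = S"
  using torus_proj_id by (metis (no_types, lifting) image_cong image_ident subsetD)

lemma torus_proj_in_torus: "m > 0 \<Longrightarrow> n > 0 \<Longrightarrow> torus_proj m n P \<in> torus m n"
  by (cases P) (simp add: torus_def torus_proj_def)

lemma card_torus: "card (torus m n) = m * n"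
  by (simp add: torus_def)

lemma no_three_collinear_card_le_2:
  assumes "finite S" "card S \<le> 2"
  shows "no_three_collinear m n S"
  unfolding no_three_collinear_def
proof (intro ballI impI)
  fix P Q R assume PQR: "P \<in> S" "Q \<in> S" "R \<in> S" "P \<noteq> Q \<and> P \<noteq> R \<and> Q \<noteq> R"
  then have "card {P, Q, R} \<le> card S"
    using assms(1) by (intro card_mono) auto
  with PQR(4) assms(2) show "\<not> torus_collinear m n {P, Q, R}"
    by simp
qed

lemma card_le_torus_tau:
  assumes "S \<subseteq> torus m n" "no_three_collinear m n S"
  shows "card S \<le> torus_tau m n"
  unfolding torus_tau_def using assms by (intro Max_ge[OF torus_tau_wf(1)]) blast

lemma torus_tau_leI:
  assumes "\<And>S. S \<subseteq> torus m n \<Longrightarrow> no_three_collinear m n S \<Longrightarrow> card S \<le> t"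
  shows "torus_tau m n \<le> t"
  unfolding torus_tau_def using torus_tau_wf assms by (auto simp: Max_le_iff)

theorem theorem5:
  fixes m n x y :: nat
  assumes "m > 0" and "n > 0" and "x > 0" and "y > 0"
    and "\<not> (m = 1 \<and> n = 1)"
    and "gcd x y = 1" and "gcd m y = 1" and "gcd n x = 1"
  shows "torus_tau (x * m) (y * n) = torus_tau m n"
proof (rule antisym)
  let ?M = "x * m" and ?N = "y * n" and ?f = "torus_proj m n"
  have lift: "torus_collinear ?M ?N S \<longleftrightarrow> torus_collinear m n (?f ` S)" if "S \<subseteq> torus ?M ?N" for S
    using torus_collinear_proj_mult_iff[of m n x y S] assms torus_proj_image_id[OF that]
    by (simp add: coprime_iff_gcd_eq_1)
  show "torus_tau ?M ?N \<le> torus_tau m n"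
  proof (rule torus_tau_leI)
    fix S assume S: "S \<subseteq> torus ?M ?N" "no_three_collinear ?M ?N S"
    have fin: "finite S"
      using S(1) finite_torus finite_subset by blast
    show "card S \<le> torus_tau m n"
    proof (cases "card S \<le> 2")
      case True
      \<comment> \<open>Sets of at most two points never contain a collinear triple, so it suffices
        that the small torus has room for two points; this is where \<open>m = n = 1\<close> is
        excluded.\<close>
      have "2 \<le> m * n"
        using assms(1,2,5) by (metis One_nat_def Suc_1 Suc_leI mult_eq_1_iff nat_0_less_mult_iff
          less_one linorder_neqE_nat nat_less_le)
      then obtain S' where "S' \<subseteq> torus m n" "card S' = card S"
        using True obtain_subset_with_card_n[of "card S" "torus m n"] card_torus by (metis le_trans)
      with True show ?thesis
        by (metis card_le_torus_tau no_three_collinear_card_le_2 finite_torus finite_subset)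
    next
      case False
      \<comment> \<open>If \<open>P\<close> and \<open>Q\<close> had the same image, a third point
        \<open>R\<close> would give a triple with at most two images. These are collinear, and by
        \<open>lift\<close> so is the triple.\<close>
      have inj: "inj_on ?f S"
      proof (rule inj_onI, rule ccontr)
        fix P Q assume PQ: "P \<in> S" "Q \<in> S" "?f P = ?f Q" "P \<noteq> Q"
        then have "card {P, Q} < card S"
          using False by simp
        then obtain R where R: "R \<in> S" "R \<notin> {P, Q}"
          by (metis card_mono finite.emptyI finite_insert linorder_not_less subsetI)
        have "?f ` {P, Q, R} = ?f ` {P, R}"
          using PQ(3) by auto
        then have "torus_collinear ?M ?N {P, Q, R}"
          using lift[of "{P, Q, R}"] torus_collinear_pair[of m n P R] PQ R S(1) by auto
        moreover have "P \<noteq> R" "Q \<noteq> R"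
          using R(2) by auto
        ultimately show False
          using S(2) PQ(1,2,4) R(1) unfolding no_three_collinear_def by simp
      qed
      have "no_three_collinear m n (?f ` S)"
        unfolding no_three_collinear_def
      proof (intro ballI impI)
        fix P' Q' R' assume "P' \<in> ?f ` S" "Q' \<in> ?f ` S" "R' \<in> ?f ` S"
          and ne: "P' \<noteq> Q' \<and> P' \<noteq> R' \<and> Q' \<noteq> R'"
        then obtain P Q R where PQR: "P \<in> S" "Q \<in> S" "R \<in> S"
          and eq: "P' = ?f P" "Q' = ?f Q" "R' = ?f R"
          by blast
        moreover have "P \<noteq> Q" "P \<noteq> R" "Q \<noteq> R"
          using ne eq by auto
        ultimately have "\<not> torus_collinear ?M ?N {P, Q, R}"
          using S(2) unfolding no_three_collinear_def by simp
        with PQR S(1) show "\<not> torus_collinear m n {P', Q', R'}"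
          using lift[of "{P, Q, R}"] eq by auto
      qed
      moreover have "?f ` S \<subseteq> torus m n"
        using torus_proj_in_torus assms(1,2) by blast
      ultimately have "card (?f ` S) \<le> torus_tau m n"
        by (intro card_le_torus_tau)
      with inj show ?thesis
        by (simp add: card_image)
    qed
  qed
  show "torus_tau m n \<le> torus_tau ?M ?N"
  proof (rule torus_tau_leI)
    fix S assume S: "S \<subseteq> torus m n" "no_three_collinear m n S"
    have "m \<le> ?M" "n \<le> ?N"
      using assms(3,4) by simp_all
    \<comment> \<open>No new set is needed for this inequality: \<open>S\<close> lies in the larger
      box as it stands, and the projection fixes its points.\<close>
    then have sub: "torus m n \<subseteq> torus ?M ?N"
      unfolding torus_def by (intro Sigma_mono) (auto simp flip: of_nat_mult)
    have "no_three_collinear ?M ?N S"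
      unfolding no_three_collinear_def
    proof (intro ballI impI)
      fix P Q R assume PQR: "P \<in> S" "Q \<in> S" "R \<in> S" "P \<noteq> Q \<and> P \<noteq> R \<and> Q \<noteq> R"
      then have T: "{P, Q, R} \<subseteq> torus m n"
        using S(1) by blast
      have "\<not> torus_collinear m n {P, Q, R}"
        using S(2) PQR unfolding no_three_collinear_def by simp
      then show "\<not> torus_collinear ?M ?N {P, Q, R}"
        unfolding lift[OF subset_trans[OF T sub]] torus_proj_image_id[OF T] .
    qed
    then show "card S \<le> torus_tau ?M ?N"
      using S(1) sub by (intro card_le_torus_tau) auto
  qed
qed

end
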